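(* For every even $n\geq 2$, $\mathcal{F}[A_n]=3a_{n}-a_{n-2}$ and $\mathcal{F}[B_n]=b_{n+2}+b_{n}$. Moreover, for all integers $k_0,k_1,\ldots,k_{n+1}\ge 1$, \[ \mathcal{F}[A_{n}] \leq \mathcal{F}[k_0,k_1,\ldots,k_n,k_{n+1}]\leq \mathcal{F}[B_{n}], \] and these bounds are sharp (each of the two bounds is attained for some choice of $k_0,\ldots,k_{n+1}\ge 1$).
   Context: Closed chain AND-OR networks. These are the networks $f:\{0,1\}^N\to\{0,1\}^N$ with $f_i(x)=x_{i-1}\diamondsuit_i x_{i+1}$, $i=1,\ldots,N$, with indices of the variables read modulo $N$ and $\diamondsuit_i\in\{\wedge,\vee\}$ (logical AND, OR). Such a network is denoted $[k_1,\ldots,k_r]$, where $k_1,\ldots,k_r\ge1$ are the lengths of the maximal runs of equal operators in the cyclic sequence $\diamondsuit_1,\ldots,\diamondsuit_N$, listed in cyclic order (any cyclic permutation denotes the same network up to relabeling); hence $k_1+\cdots+k_r=N$, operators alternate between $\wedge$ and $\vee$ from run to run, and $r$ is always even or equal to $1$. $\mathcal{F}[k_1,\ldots,k_r]$ is its number of fixed points ($x$ with $f(x)=x$); it does not depend on whether the first run is $\wedge$ or $\vee$. $A_n=(1,1,\ldots,1,1)$ is the sequence of $n+2$ ones and $B_n=(2,2,\ldots,2,2)$ is the sequence of $n+2$ twos; $\mathcal{F}[A_n]$ and $\mathcal{F}[B_n]$ are the numbers of fixed points of the closed chain networks $[1,1,\ldots,1]$ and $[2,2,\ldots,2]$ with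 $n+2$ runs. The sequence $(a_n)$ is defined by $a_0=a_1=a_2=1$ and $a_n=a_{n-2}+a_{n-3}$ for $n\ge 3$; the sequence $(b_n)$ is defined by $b_0=b_1=1$ and $b_n=b_{n-1}+b_{n-2}$ for $n\ge 2$. *)

theory Defs
  imports Main
begin

text \<open>
  States in \<open>{0,1}\<^sup>N\<close> are represented as Boolean lists of length \<open>N\<close>, and positions are numbered
  \<open>0, \<dots>, N - 1\<close> instead of \<open>1, \<dots>, N\<close>.
\<close>

datatype gate = And | Or

fun gate_fun :: "gate \<Rightarrow> bool \<Rightarrow> bool \<Rightarrow> bool" where
  "gate_fun And p q = (p \<and> q)"
| "gate_fun Or p q = (p \<or> q)"

fun dual_gate :: "gate \<Rightarrow> gate" where
  "dual_gate And = Or"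
| "dual_gate Or = And"

text \<open>
  The left neighbour of \<open>i\<close> is written \<open>(i + N - 1) mod N\<close>, since \<open>i - 1\<close> on the natural numbers
  would send \<open>0\<close> to \<open>0\<close>.
\<close>

definition closed_chain :: "gate list \<Rightarrow> bool list \<Rightarrow> bool list" where
  "closed_chain gs x =
     (let N = length gs in
      map (\<lambda>i. gate_fun (gs ! i) (x ! ((i + N - 1) mod N)) (x ! ((i + 1) mod N))) [0..<N])"

definition num_fixed_points :: "nat \<Rightarrow> (bool list \<Rightarrow> bool list) \<Rightarrow> nat" where
  "num_fixed_points N f = card {x. length x = N \<and> f x = x}"

text \<open>
  The gates of the network \<open>[k\<^sub>1, \<dots>, k\<^sub>r]\<close> whose first run consists of the gate \<open>g\<close>. The \<open>k\<^sub>i\<close> are the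
  lengths of the maximal runs of this cyclic sequence when all \<open>k\<^sub>i \<ge> 1\<close> and \<open>r\<close> is even or \<open>r = 1\<close>.
\<close>

fun gates_of_runs :: "gate \<Rightarrow> nat list \<Rightarrow> gate list" where
  "gates_of_runs g [] = []"
| "gates_of_runs g (k # ks) = replicate k g @ gates_of_runs (dual_gate g) ks"

text \<open>
  The first run is taken to be \<open>\<and>\<close>; the lemma \<open>num_fixed_points_first_gate\<close> below shows that this
  choice is immaterial.
\<close>

definition fixed_points_count :: "nat list \<Rightarrow> nat"  (\<open>\<F>\<close>) where
  "\<F> ks = num_fixed_points (sum_list ks) (closed_chain (gates_of_runs And ks))"

definition A_seq :: "nat \<Rightarrow> nat list" where
  "A_seq n = replicate (n + 2) 1"

definition B_seq :: "nat \<Rightarrow> nat list" where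
  "B_seq n = replicate (n + 2) 2"

fun a_seq :: "nat \<Rightarrow> nat" where
  "a_seq 0 = 1"
| "a_seq (Suc 0) = 1"
| "a_seq (Suc (Suc 0)) = 1"
| "a_seq (Suc (Suc (Suc n))) = a_seq (Suc n) + a_seq n"

fun b_seq :: "nat \<Rightarrow> nat" where
  "b_seq 0 = 1"
| "b_seq (Suc 0) = 1"
| "b_seq (Suc (Suc n)) = b_seq (Suc n) + b_seq n"

lemma length_gates_of_runs [simp]: "length (gates_of_runs g ks) = sum_list ks"
  by (induction ks arbitrary: g) auto

lemma gates_of_runs_dual: "gates_of_runs (dual_gate g) ks = map dual_gate (gates_of_runs g ks)"
  by (induction ks arbitrary: g) auto

lemma gate_fun_dual: "gate_fun (dual_gate g) (\<not> p) (\<not> q) = (\<not> gate_fun g p q)"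
  by (cases g) auto

lemma closed_chain_dual:
  assumes "length x = length gs"
  shows "closed_chain (map dual_gate gs) (map Not x) = map Not (closed_chain gs x)"
proof (rule nth_equalityI)
  show "length (closed_chain (map dual_gate gs) (map Not x)) = length (map Not (closed_chain gs x))"
    by (simp add: closed_chain_def Let_def)
next
  fix i assume "i < length (closed_chain (map dual_gate gs) (map Not x))"
  then have i: "i < length gs" by (simp add: closed_chain_def Let_def)
  then have "(i + length gs - 1) mod length gs < length x" "(i + 1) mod length gs < length x"
    using assms by (auto intro!: mod_less_divisor)
  then show "closed_chain (map dual_gate gs) (map Not x) ! i = map Not (closed_chain gs x) ! i"
    using i by (simp add: closed_chain_def Let_def gate_fun_dual)
qed

lemma num_fixed_points_first_gate:
  "num_fixed_points (sum_list ks) (closed_chain (gates_of_runs g ks)) = \<F> ks"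
proof (cases g)
  case And
  then show ?thesis by (simp add: fixed_points_count_def)
next
  case Or
  let ?F = "\<lambda>g. {x. length x = sum_list ks \<and> closed_chain (gates_of_runs g ks) x = x}"
  have step: "map Not x \<in> ?F (dual_gate h)" if "x \<in> ?F h" for h x
    using that closed_chain_dual[of x "gates_of_runs h ks"] by (simp add: gates_of_runs_dual)
  have inv: "map Not (map Not x) = x" for x
    by (simp add: comp_def)
  have "bij_betw (map Not) (?F Or) (?F And)"
    by (rule bij_betw_byWitness[where f' = "map Not"])
       (use inv step[of _ Or] step[of _ And] in auto)
  then show ?thesis
    unfolding Or fixed_points_count_def num_fixed_points_def by (rule bij_betw_same_card)
qed

end

theory Submission
  imports Defs
begin

text \<open>
  A fixed point is constant on every run: inside a run of \<open>\<and>\<close> a single \<open>1\<close> forces both of its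
  neighbours to be \<open>1\<close>, hence the whole run and the two adjacent positions, and dually for a \<open>0\<close> in
  a run of \<open>\<or>\<close>. So call a run \<^emph>\<open>active\<close> if its constant value is \<open>1\<close> for \<open>\<and>\<close>, respectively \<open>0\<close>
  for \<open>\<or>\<close>. An active run forces its two neighbouring runs to be inactive. An inactive run of length
  at least two supports its value by itself, since every position has a neighbour with the same value
  in the run; an inactive run of length one needs an active neighbour. Hence the fixed
  points of \<open>[k\<^sub>1, \<dots>, k\<^sub>r]\<close> correspond to the independent sets of the cycle with \<open>r\<close> vertices in
  which every vertex \<open>j\<close> with \<open>k\<^sub>j = 1\<close> is in the set or adjacent to it
  (\<open>fixed_points_count_eq_card_run_states\<close>).

  The lengths thus matter only through the set of \<open>j\<close> with \<open>k\<^sub>j = 1\<close>, and enlarging this set can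
  only destroy fixed points (\<open>card_run_states_mono\<close>). The extreme cases are all lengths one, which
  gives the maximal independent sets of the cycle, and all lengths two, which gives all
  independent sets. This proves the bounds and their sharpness.

  Both extreme cases are counted by cutting the cycle open at two adjacent vertices: for
  prescribed states at the two ends, the number of ways to fill the gap satisfies a linear
  recurrence in the length of the gap. It is the Padovan recurrence for maximal independent sets
  (\<open>paths_maximal\<close>), as two consecutive members then lie at distance two or three, and the
  Fibonacci recurrence for all independent sets (\<open>paths_independent\<close>).
\<close>

section \<open>Windows of length three\<close>

text \<open>
  Both the networks and the independent sets are given by a condition on each position and its two
  neighbours. The list of values has one additional entry at each end, holding the neighbours of
  the first and the last position, so that a closed chain is an open one whose boundary
  entries are copied from the opposite ends.
\<close>

fun windows :: "('a \<Rightarrow> 'b \<Rightarrow> 'b \<Rightarrow> 'b \<Rightarrow> bool) \<Rightarrow> 'a list \<Rightarrow> 'b list \<Rightarrow> bool" where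
  "windows P (a # as) (x # y # z # zs) = (P a x y z \<and> windows P as (y # z # zs))"
| "windows P [] [x, y] = True"
| "windows P _ _ = False"

definition windows_cyclic :: "('a \<Rightarrow> 'b \<Rightarrow> 'b \<Rightarrow> 'b \<Rightarrow> bool) \<Rightarrow> 'a list \<Rightarrow> 'b list \<Rightarrow> bool" where
  "windows_cyclic P as xs = windows P as (last xs # xs @ [hd xs])"

lemma windows_iff_nth:
  assumes "length xs = length as + 2"
  shows "windows P as xs \<longleftrightarrow> (\<forall>i < length as. P (as ! i) (xs ! i) (xs ! (i + 1)) (xs ! (i + 2)))"
  using assms
proof (induction P as xs rule: windows.induct)
  case (1 P a as x y z zs)
  then show ?case by (auto simp: All_less_Suc2 simp del: All_less_Suc)
qed (auto simp: length_Suc_conv)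

lemma windows_Cons:
  "zs \<noteq> [] \<Longrightarrow> windows P (a # as) (x # y # zs) \<longleftrightarrow> P a x y (hd zs) \<and> windows P as (y # zs)"
  by (cases zs) simp_all

text \<open>
  Cutting a chain leaves each part with the adjacent value of the other part as its boundary entry;
  \<open>hd (ys @ [r])\<close> and \<open>last (l # xs)\<close> are these values also when a part is empty.
\<close>

lemma windows_append:
  assumes "length xs = length as"
  shows "windows P (as @ bs) (l # xs @ ys @ [r])
    \<longleftrightarrow> windows P as (l # xs @ [hd (ys @ [r])]) \<and> windows P bs (last (l # xs) # ys @ [r])"
  using assms
proof (induction as arbitrary: l xs)
  case Nil
  then show ?case by simp
next
  case (Cons a as)
  then obtain x xs' where xs: "xs = x # xs'" "length xs' = length as"
    by (auto simp: length_Suc_conv)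
  show ?case
    using Cons.IH[OF xs(2), of x] by (simp add: xs(1) windows_Cons hd_append)
qed

lemma windows_mono:
  assumes "list_all2 (\<lambda>a b. \<forall>x y z. P a x y z \<longrightarrow> P b x y z) as bs" and "windows P as xs"
  shows "windows P bs xs"
  using assms
proof (induction as bs arbitrary: xs rule: list_all2_induct)
  case Nil
  then show ?case by simp
next
  case (Cons a as b bs)
  then obtain x y z zs where xs: "xs = x # y # z # zs"
    by (cases "(P, a # as, xs)" rule: windows.cases) auto
  show ?case
    using Cons.prems Cons.IH[of "y # z # zs"] Cons.hyps(1) unfolding xs by simp
qed

definition obeys_gate :: "gate \<Rightarrow> bool \<Rightarrow> bool \<Rightarrow> bool \<Rightarrow> bool" where
  "obeys_gate g x y z \<longleftrightarrow> y = gate_fun g x z"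

lemma closed_chain_fixed_iff:
  assumes len: "length x = length gs" and "x \<noteq> []"
  shows "closed_chain gs x = x \<longleftrightarrow> windows_cyclic obeys_gate gs x"
proof -
  let ?N = "length gs" and ?p = "last x # x @ [hd x]"
  have N: "?N > 0" using assms by auto
  have left: "x ! ((i + ?N - 1) mod ?N) = ?p ! i" if "i < ?N" for i
  proof (cases i)
    case 0
    then show ?thesis using assms N by (simp add: last_conv_nth)
  next
    case (Suc j)
    then have "(i + ?N - 1) mod ?N = j" using that by simp
    then show ?thesis using Suc that len by (simp add: nth_append)
  qed
  have right: "x ! ((i + 1) mod ?N) = ?p ! (i + 2)" if "i < ?N" for i
  proof (cases "i + 1 = ?N")
    case True
    then show ?thesis using assms by (simp add: nth_append hd_conv_nth)
  next
    case False
    then show ?thesis using that len by (simp add: nth_append)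
  qed
  have mid: "?p ! (i + 1) = x ! i" if "i < ?N" for i
    using that len by (simp add: nth_append)
  have "closed_chain gs x = x \<longleftrightarrow>
      (\<forall>i < ?N. x ! i = gate_fun (gs ! i) (x ! ((i + ?N - 1) mod ?N)) (x ! ((i + 1) mod ?N)))"
    using len unfolding closed_chain_def Let_def list_eq_iff_nth_eq by auto
  also have "\<dots> \<longleftrightarrow> (\<forall>i < ?N. obeys_gate (gs ! i) (?p ! i) (?p ! (i + 1)) (?p ! (i + 2)))"
    using left right mid by (simp add: obeys_gate_def)
  also have "\<dots> \<longleftrightarrow> windows_cyclic obeys_gate gs x"
    unfolding windows_cyclic_def using len by (subst windows_iff_nth) auto
  finally show ?thesis .
qed

section \<open>From fixed points to independent sets\<close>

text \<open>
  The value of a run of \<open>g\<close>, given whether the run is active. In terms of activity the condition on a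
  run no longer depends on its gate.
\<close>

definition run_value :: "gate \<Rightarrow> bool \<Rightarrow> bool" where
  "run_value g t \<longleftrightarrow> t = (g = And)"

fun expand :: "gate \<Rightarrow> nat list \<Rightarrow> bool list \<Rightarrow> bool list" where
  "expand g (k # ks) (t # ts) = replicate k (run_value g t) @ expand (dual_gate g) ks ts"
| "expand g _ _ = []"

definition obeys_run :: "nat \<Rightarrow> bool \<Rightarrow> bool \<Rightarrow> bool \<Rightarrow> bool" where
  "obeys_run k x y z \<longleftrightarrow> (y \<longrightarrow> \<not> x \<and> \<not> z) \<and> (k = 1 \<longrightarrow> x \<or> y \<or> z)"

definition run_states :: "nat list \<Rightarrow> bool list set" where
  "run_states ks = {ts. length ts = length ks \<and> windows_cyclic obeys_run ks ts}"

lemma dual_gate_dual_gate [simp]: "dual_gate (dual_gate g) = g"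
  by (cases g) auto

lemma run_value_eq_iff [simp]: "run_value g t = run_value g u \<longleftrightarrow> t = u"
  by (auto simp: run_value_def)

lemma run_value_surj: "\<exists>t. v = run_value g t"
  by (auto simp: run_value_def)

lemma length_expand [simp]: "length ts = length ks \<Longrightarrow> length (expand g ks ts) = sum_list ks"
  by (induction g ks ts rule: expand.induct) auto

lemma hd_expand:
  assumes "length ts = length ks" and "\<forall>k \<in> set ks. k \<ge> 1"
  shows "hd (expand g ks ts @ [run_value g r]) = run_value g (hd (ts @ [r]))"
  using assms by (cases ks; cases ts) (auto simp: hd_append)

lemma last_expand:
  assumes "length ts = length ks" and "\<forall>k \<in> set ks. k \<ge> 1" and "even (length ks)" and "ks \<noteq> []"
  shows "last (expand g ks ts) = run_value (dual_gate g) (last ts)"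
  using assms
proof (induction ks arbitrary: ts rule: induct_list012)
  case (3 k k' ks)
  then obtain t t' us where ts: "ts = t # t' # us" "length us = length ks"
    by (auto simp: length_Suc_conv)
  show ?case
  proof (cases "ks = []")
    case True
    then show ?thesis using 3 ts by simp
  next
    case False
    with ts have "us \<noteq> []" by auto
    moreover from False have "expand g ks us \<noteq> []"
      using 3(4) ts(2) by (cases ks; cases us) auto
    ultimately show ?thesis using 3 ts False by simp
  qed
qed auto

lemma expand_inj:
  assumes "length ts = length ks" "length us = length ks" "\<forall>k \<in> set ks. k \<ge> 1"
    and "expand g ks ts = expand g ks us"
  shows "ts = us"
  using assms
proof (induction ks arbitrary: g ts us)
  case (Cons k ks)
  then obtain t ts' u us' where "ts = t # ts'" "us = u # us'"
    by (auto simp: length_Suc_conv)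
  with Cons show ?case by (auto simp: replicate_eq_replicate)
qed simp

text \<open>
  Two adjacent positions with the same gate agree: a position with value \<open>1\<close> and gate \<open>\<and>\<close>, or with
  value \<open>0\<close> and gate \<open>\<or>\<close>, forces its value on its neighbours.
\<close>

lemma run_constant:
  assumes "windows obeys_gate (replicate k g) (l # xs @ [r])" and "length xs = k"
  shows "\<exists>v. xs = replicate k v"
  using assms
proof (induction k arbitrary: l xs)
  case (Suc k)
  then obtain x xs' where xs: "xs = x # xs'" "length xs' = k" by (auto simp: length_Suc_conv)
  have "windows obeys_gate (replicate k g) (x # xs' @ [r])"
    using Suc.prems xs by (cases xs') auto
  with Suc.IH xs obtain v where v: "xs' = replicate k v" by blast
  show ?case
  proof (cases k)
    case 0
    then show ?thesis using xs v by auto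
  next
    case (Suc m)
    obtain z zs where "replicate m v @ [r] = z # zs" by (cases m) auto
    then have "obeys_gate g l x v" "obeys_gate g x v z"
      using Suc.prems(1) unfolding xs(1) v Suc by simp_all
    then have "x = v" by (cases g) (auto simp: obeys_gate_def)
    then show ?thesis using xs v by auto
  qed
qed simp

text \<open>
  Gates are idempotent, so a position between two equal values imposes no condition on a constant
  block. Applied to all positions of a run but the first, this settles the runs of length at
  least two.
\<close>

lemma windows_constant:
  "windows obeys_gate (replicate (Suc k) g) (v # replicate (Suc k) v @ [r]) \<longleftrightarrow> v = gate_fun g v r"
proof (induction k)
  case (Suc k)
  have "gate_fun g v v = v" by (cases g) auto
  with Suc show ?case by (auto simp: obeys_gate_def)
qed (simp add: obeys_gate_def)

lemma windows_run:
  assumes "k \<ge> 1"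
  shows "windows obeys_gate (replicate k g)
      (run_value (dual_gate g) l # replicate k (run_value g t) @ [run_value (dual_gate g) r])
    \<longleftrightarrow> obeys_run k l t r"
proof (cases "k = 1")
  case True
  then show ?thesis by (cases g) (auto simp: obeys_gate_def obeys_run_def run_value_def)
next
  case False
  with assms obtain m where k: "k = Suc (Suc m)" by (metis One_nat_def not0_implies_Suc not_one_le_zero)
  then show ?thesis
    using windows_constant[of m g "run_value g t" "run_value (dual_gate g) r"]
    by (cases g) (auto simp: obeys_gate_def obeys_run_def run_value_def)
qed

text \<open>
  The gate alternates from run to run, so the run after the last one has gate \<open>g\<close> or its dual
  according to the parity of the number of runs. For an even number it is the gate of the
  first run, as a closed chain requires.
\<close>

lemma windows_expand:
  assumes "length ts = length ks" and "\<forall>k \<in> set ks. k \<ge> 1"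
  shows "windows obeys_gate (gates_of_runs g ks)
      (run_value (dual_gate g) l # expand g ks ts
        @ [run_value (if even (length ks) then g else dual_gate g) r])
    \<longleftrightarrow> windows obeys_run ks (l # ts @ [r])"
  using assms
proof (induction ks arbitrary: g l ts)
  case (Cons k ks)
  then obtain t ts' where ts: "ts = t # ts'" "length ts' = length ks"
    by (auto simp: length_Suc_conv)
  let ?h = "if even (length ks) then dual_gate g else g"
  have *: "hd (expand (dual_gate g) ks ts' @ [run_value ?h r]) = run_value (dual_gate g) (hd (ts' @ [r]))"
  proof (cases "ks = []")
    case True
    then show ?thesis using ts by simp
  next
    case False
    then show ?thesis
      using hd_expand[OF ts(2), of "dual_gate g" r] Cons.prems(2) ts(2)
      by (cases ks; cases ts') (auto simp: hd_append)
  qed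
  have "windows obeys_gate (gates_of_runs g (k # ks))
      (run_value (dual_gate g) l # expand g (k # ks) ts @ [run_value ?h r]) \<longleftrightarrow>
    windows obeys_gate (replicate k g) (run_value (dual_gate g) l # replicate k (run_value g t)
        @ [run_value (dual_gate g) (hd (ts' @ [r]))]) \<and>
    windows obeys_gate (gates_of_runs (dual_gate g) ks)
        (run_value g t # expand (dual_gate g) ks ts' @ [run_value ?h r])"
    using Cons.prems(2) windows_append[of "replicate k (run_value g t)" "replicate k g" obeys_gate]
    by (simp add: ts *)
  also have "\<dots> \<longleftrightarrow> obeys_run k l t (hd (ts' @ [r])) \<and> windows obeys_run ks (t # ts' @ [r])"
    using Cons.prems(2) windows_run[of k g l t] Cons.IH[OF ts(2), of "dual_gate g" t]
    by (simp only: dual_gate_dual_gate) simp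
  also have "\<dots> \<longleftrightarrow> windows obeys_run (k # ks) (l # ts @ [r])"
    using ts(1) by (cases ts') auto
  also have "?h = (if even (length (k # ks)) then g else dual_gate g)"
    by simp
  finally show ?case .
qed simp

lemma windows_gates_imp_expand:
  assumes "windows obeys_gate (gates_of_runs g ks) (l # xs @ [r])" and "length xs = sum_list ks"
  shows "\<exists>ts. length ts = length ks \<and> xs = expand g ks ts"
  using assms
proof (induction ks arbitrary: g l xs)
  case (Cons k ks)
  define ys zs where "ys = take k xs" and "zs = drop k xs"
  have xs: "xs = ys @ zs" "length ys = k" "length zs = sum_list ks"
    using Cons.prems(2) by (auto simp: ys_def zs_def)
  have *: "windows obeys_gate (replicate k g) (l # ys @ [hd (zs @ [r])])"
    "windows obeys_gate (gates_of_runs (dual_gate g) ks) (last (l # ys) # zs @ [r])"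
    using Cons.prems(1) windows_append[of ys "replicate k g" obeys_gate _ l zs r] xs by auto
  obtain v where "ys = replicate k v" using run_constant[OF *(1) xs(2)] by blast
  moreover obtain t where "v = run_value g t" using run_value_surj by blast
  moreover obtain ts where "length ts = length ks" "zs = expand (dual_gate g) ks ts"
    using Cons.IH[OF *(2) xs(3)] by blast
  ultimately show ?case using xs(1) by (intro exI[of _ "t # ts"]) simp
qed simp

text \<open>
  A run of odd index has gate \<open>\<or>\<close> and one of even index \<open>\<and>\<close> (counting from zero), so with an even number
  of runs the cyclically last and first runs also have dual gates, and the conditions on runs close
  up to a condition on a cycle.
\<close>

theorem fixed_points_count_eq_card_run_states:
  assumes "even (length ks)" and "ks \<noteq> []" and pos: "\<forall>k \<in> set ks. k \<ge> 1"
  shows "\<F> ks = card (run_states ks)"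
proof -
  let ?gs = "gates_of_runs And ks"
  have "sum_list ks > 0" using assms by (cases ks) auto
  then have cyc: "closed_chain ?gs x = x \<longleftrightarrow> windows_cyclic obeys_gate ?gs x"
    if "length x = sum_list ks" for x
    using that by (intro closed_chain_fixed_iff) (auto simp del: sum_list_eq_0_iff)
  have transl: "windows_cyclic obeys_gate ?gs (expand And ks ts) \<longleftrightarrow> windows_cyclic obeys_run ks ts"
    if len: "length ts = length ks" for ts
  proof -
    have "ts \<noteq> []" using len assms(2) by auto
    moreover have "expand And ks ts \<noteq> []"
      using length_expand[OF len, of And] \<open>sum_list ks > 0\<close> by (metis list.size(3) less_irrefl)
    ultimately have "hd (expand And ks ts) = run_value And (hd ts)"
      using hd_expand[OF len pos, of And] by simp
    then show ?thesis
      using windows_expand[OF len pos, of And "last ts" "hd ts"] last_expand[OF len pos assms(1,2)]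
        assms(1) by (simp add: windows_cyclic_def)
  qed
  have "{x. length x = sum_list ks \<and> closed_chain ?gs x = x} = expand And ks ` run_states ks"
  proof (intro equalityI subsetI)
    fix x assume "x \<in> {x. length x = sum_list ks \<and> closed_chain ?gs x = x}"
    then have x: "length x = sum_list ks" "windows_cyclic obeys_gate ?gs x"
      using cyc by auto
    then obtain ts where "length ts = length ks" "x = expand And ks ts"
      using windows_gates_imp_expand unfolding windows_cyclic_def by blast
    with x(2) transl show "x \<in> expand And ks ` run_states ks" by (auto simp: run_states_def)
  next
    fix x assume "x \<in> expand And ks ` run_states ks"
    then show "x \<in> {x. length x = sum_list ks \<and> closed_chain ?gs x = x}"
      by (auto simp: run_states_def cyc transl)
  qed
  moreover have "inj_on (expand And ks) (run_states ks)"
    using expand_inj pos by (auto simp: inj_on_def run_states_def)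
  ultimately show ?thesis
    unfolding fixed_points_count_def num_fixed_points_def by (simp add: card_image)
qed

section \<open>Dependence on the lengths of the runs\<close>

lemma finite_run_states: "finite (run_states ks)"
  by (rule finite_subset[OF _ finite_lists_length_eq[of UNIV "length ks"]])
     (auto simp: run_states_def)

lemma card_run_states_mono:
  assumes "list_all2 (\<lambda>k k'. k' = 1 \<longrightarrow> k = 1) ks ks'"
  shows "card (run_states ks) \<le> card (run_states ks')"
proof (rule card_mono[OF finite_run_states])
  have "list_all2 (\<lambda>k k'. \<forall>x y z. obeys_run k x y z \<longrightarrow> obeys_run k' x y z) ks ks'"
    using assms by (rule list_all2_mono) (auto simp: obeys_run_def)
  then have "windows obeys_run ks' xs" if "windows obeys_run ks xs" for xs
    using that by (rule windows_mono)
  then show "run_states ks \<subseteq> run_states ks'"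
    using list_all2_lengthD[OF assms] unfolding run_states_def windows_cyclic_def by auto
qed

section \<open>Counting run states\<close>

text \<open>
  The number of ways to fill a gap of \<open>m\<close> runs of length \<open>k\<close> between the states \<open>x, y\<close> and \<open>u, v\<close>. Two
  states at each end are needed because the condition on a run involves both of its neighbours. The
  conditions on the runs with states \<open>y\<close> and \<open>u\<close> are included, which accounts for \<open>m + 2\<close>.
\<close>

definition paths :: "nat \<Rightarrow> bool \<Rightarrow> bool \<Rightarrow> bool \<Rightarrow> bool \<Rightarrow> nat \<Rightarrow> nat" where
  "paths k x y u v m =
     card {ts. length ts = m \<and> windows obeys_run (replicate (m + 2) k) (x # y # ts @ [u, v])}"

lemma card_lists_length_Suc:
  "card {ts. length ts = Suc m \<and> P ts}
    = card {ts :: bool list. length ts = m \<and> P (True # ts)} + card {ts. length ts = m \<and> P (False # ts)}"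
proof -
  have fin: "finite {ts :: bool list. length ts = m \<and> Q ts}" for Q
    by (rule finite_subset[OF _ finite_lists_length_eq[of UNIV m]]) auto
  have "{ts. length ts = Suc m \<and> P ts} = Cons True ` {ts. length ts = m \<and> P (True # ts)}
      \<union> Cons False ` {ts. length ts = m \<and> P (False # ts)}"
    by (auto simp: length_Suc_conv image_iff) (metis (full_types))+
  moreover have "card (Cons b ` {ts. length ts = m \<and> P (b # ts)}) = card {ts. length ts = m \<and> P (b # ts)}" for b
    by (simp add: card_image)
  moreover have "Cons True ` X \<inter> Cons False ` Y = {}" for X Y by auto
  ultimately show ?thesis by (simp only: card_Un_disjoint finite_imageI fin)
qed

lemma paths_0:
  "paths k x y u v 0 = (if obeys_run k x y u \<and> obeys_run k y u v then 1 else 0)"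
proof -
  have "{ts :: bool list. length ts = 0 \<and> windows obeys_run (replicate (0 + 2) k) (x # y # ts @ [u, v])}
      = (if obeys_run k x y u \<and> obeys_run k y u v then {[]} else {})"
    by (auto simp: numeral_2_eq_2)
  then show ?thesis unfolding paths_def by simp
qed

lemma paths_Suc:
  "paths k x y u v (Suc m) =
     (if obeys_run k x y True then paths k y True u v m else 0) +
     (if obeys_run k x y False then paths k y False u v m else 0)"
  unfolding paths_def by (simp add: card_lists_length_Suc)

text \<open>
  The cyclic condition on \<open>ts\<close> is the condition on the open chain \<open>last ts # ts @ [hd ts]\<close>, which begins
  and ends with the same two states \<open>last ts, hd ts\<close>. Rotating \<open>ts\<close> by one step puts these two states
  in front, and the count splits according to their four possible values.
\<close>

lemma card_run_states_replicate:
  "card (run_states (replicate (m + 2) k)) =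
     paths k True True True True m + paths k True False True False m
     + paths k False True False True m + paths k False False False False m"
proof -
  let ?W = "\<lambda>x y ts. windows obeys_run (replicate (m + 2) k) (x # y # ts @ [x, y])"
  let ?S = "{ts. length ts = Suc (Suc m) \<and> ?W (hd ts) (hd (tl ts)) (tl (tl ts))}"
  have rotate: "bij_betw (\<lambda>ts. last ts # butlast ts) (run_states (replicate (m + 2) k)) ?S"
  proof (rule bij_betw_byWitness[where f' = "\<lambda>ts. tl ts @ [hd ts]"])
    show "(\<lambda>ts. last ts # butlast ts) ` run_states (replicate (m + 2) k) \<subseteq> ?S"
    proof (clarsimp simp: run_states_def windows_cyclic_def)
      fix ts :: "bool list"
      assume len: "length ts = Suc (Suc m)"
        and W: "windows obeys_run (k # k # replicate m k) (last ts # ts @ [hd ts])"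
      obtain t us where ts: "ts = t # us" "length us = Suc m" using len by (cases ts) auto
      then obtain ms z where "us = ms @ [z]" by (cases us rule: rev_cases) auto
      with ts W show "windows obeys_run (k # k # replicate m k)
          (last ts # hd (butlast ts) # tl (butlast ts) @ [last ts, hd (butlast ts)])"
        by simp
    qed
    show "(\<lambda>ts. tl ts @ [hd ts]) ` ?S \<subseteq> run_states (replicate (m + 2) k)"
    proof clarify
      fix ts :: "bool list"
      assume len: "length ts = Suc (Suc m)" and W: "?W (hd ts) (hd (tl ts)) (tl (tl ts))"
      then obtain x y us where "ts = x # y # us" "length us = m"
        by (auto simp: length_Suc_conv)
      with W show "tl ts @ [hd ts] \<in> run_states (replicate (m + 2) k)"
        by (simp add: run_states_def windows_cyclic_def)
    qed
  qed (auto simp: run_states_def length_Suc_conv)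
  have "card (run_states (replicate (m + 2) k)) = card ?S"
    by (rule bij_betw_same_card[OF rotate])
  also have "\<dots> = card {ts. length ts = m \<and> ?W True True ts} + card {ts. length ts = m \<and> ?W True False ts}
      + (card {ts. length ts = m \<and> ?W False True ts} + card {ts. length ts = m \<and> ?W False False ts})"
    by (simp only: card_lists_length_Suc list.sel)
  finally show ?thesis unfolding paths_def by simp
qed

lemma paths_True_True [simp]: "paths k True True u v m = 0"
  by (cases m) (simp_all add: paths_0 paths_Suc obeys_run_def)

text \<open>
  For runs of length one, the two latest states, of which at most one is \<open>True\<close>, determine the next one
  except after \<open>True, False\<close>, where both continuations are possible: the next member of a maximal independent set comes after two
  or three steps. Unfolding three steps therefore leaves gaps shorter by two and by three.
\<close>

lemma paths_maximal:
  "paths (Suc 0) x y u v (Suc (Suc (Suc m))) = paths (Suc 0) x y u v (Suc m) + paths (Suc 0) x y u v m"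
  by (cases x; cases y) (simp_all add: paths_Suc obeys_run_def)

text \<open>
  For independent sets the continuation after an omitted vertex does not depend on what precedes that
  vertex. The next vertex is then either left out, or taken together with a forced omission after it.
\<close>

lemma paths_independent:
  "paths 2 x y u v (Suc (Suc m)) = paths 2 x y u v (Suc m) + paths 2 x y u v m"
proof -
  have "paths 2 True False u v m = paths 2 False False u v m"
    by (cases m) (simp_all add: paths_0 paths_Suc obeys_run_def)
  then show ?thesis
    by (cases x; cases y) (simp_all add: paths_Suc obeys_run_def)
qed

text \<open>These are the Lucas numbers.\<close>

lemma card_run_states_twos:
  "card (run_states (replicate (m + 2) 2)) = b_seq (m + 2) + b_seq m"
  unfolding card_run_states_replicate
proof (induction m rule: b_seq.induct)
  case (3 m)
  then show ?case by (simp add: paths_independent)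
qed (simp_all add: paths_0 paths_Suc obeys_run_def)

text \<open>
  These are the Perrin numbers. The right-hand side satisfies the Padovan recurrence from
  \<open>m = 2\<close> on, so that the shifted induction starts from the counts for cycles of four, five and six
  vertices.
\<close>

lemma card_run_states_ones:
  assumes "m \<ge> 2"
  shows "int (card (run_states (replicate (m + 2) 1))) = 3 * int (a_seq m) - int (a_seq (m - 2))"
proof -
  have "int (card (run_states (replicate (m + 2 + 2) 1))) = 3 * int (a_seq (m + 2)) - int (a_seq m)" for m
    unfolding card_run_states_replicate
  proof (induction m rule: a_seq.induct)
    case (4 m)
    then show ?case by (simp add: paths_maximal)
  qed (simp_all add: paths_0 paths_Suc obeys_run_def numeral_eq_Suc)
  from this[of "m - 2"] show ?thesis
    using assms by (simp only: le_add_diff_inverse2)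
qed

section \<open>Bounds on the number of fixed points\<close>

theorem corollary3p5:
  fixes n :: nat
  assumes "even n" and "n \<ge> 2"
  shows "int (\<F> (A_seq n)) = 3 * int (a_seq n) - int (a_seq (n - 2))
       \<and> \<F> (B_seq n) = b_seq (n + 2) + b_seq n
       \<and> (\<forall>ks :: nat list. length ks = n + 2 \<and> (\<forall>k \<in> set ks. k \<ge> 1) \<longrightarrow>
            \<F> (A_seq n) \<le> \<F> ks \<and> \<F> ks \<le> \<F> (B_seq n))
       \<and> (\<exists>ks :: nat list. length ks = n + 2 \<and> (\<forall>k \<in> set ks. k \<ge> 1) \<and> \<F> ks = \<F> (A_seq n))
       \<and> (\<exists>ks :: nat list. length ks = n + 2 \<and> (\<forall>k \<in> set ks. k \<ge> 1) \<and> \<F> ks = \<F> (B_seq n))"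
proof -
  have count: "\<F> ks = card (run_states ks)" if "length ks = n + 2" "\<forall>k \<in> set ks. k \<ge> 1" for ks
    using that assms(1) by (intro fixed_points_count_eq_card_run_states) auto
  have A: "length (A_seq n) = n + 2" "\<forall>k \<in> set (A_seq n). k \<ge> 1"
    and B: "length (B_seq n) = n + 2" "\<forall>k \<in> set (B_seq n). k \<ge> 1"
    by (simp_all add: A_seq_def B_seq_def)
  have "\<F> (A_seq n) \<le> \<F> ks \<and> \<F> ks \<le> \<F> (B_seq n)"
    if ks: "length ks = n + 2" "\<forall>k \<in> set ks. k \<ge> 1" for ks
    unfolding count[OF ks] count[OF A] count[OF B] using ks(1)
    by (intro conjI card_run_states_mono) (auto simp: A_seq_def B_seq_def list_all2_conv_all_nth simp del: replicate_Suc)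
  moreover have "int (\<F> (A_seq n)) = 3 * int (a_seq n) - int (a_seq (n - 2))"
    using card_run_states_ones[OF assms(2)] count[OF A] by (simp add: A_seq_def)
  moreover have "\<F> (B_seq n) = b_seq (n + 2) + b_seq n"
    using card_run_states_twos[of n] count[OF B] by (simp add: B_seq_def)
  ultimately show ?thesis using A B by blast
qed

end
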